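(* Let $C \subsetneq \mathbb{R}^d$ be a closed convex cone with $0 \in C$ and let $X \colon \Omega \to \mathbb{R}^d$ be a random variable. For all $p \in (0,1)$ and all $w \in C^+\setminus\{0\}$, \[ Q^+_{X,w}(p) = \{z \in \mathbb{R}^d \mid w^Tz \leq q^+_{w^TX}(p)\}, \] where $q^+_{w^TX}(p) = \sup\{s \in \mathbb{R} \mid P(w^TX < s) \leq p\}$. Moreover, for all $p \in (0,1)$, \[ Q^+_{X,C}(p) = \bigcap_{w \in C^+\setminus\{0\}} \{z \in \mathbb{R}^d \mid w^Tz \leq q^+_{w^TX}(p)\}. \]
   Context: $(\Omega,\mathcal{F},P)$ is a probability space; random variables $\Omega \to \mathbb{R}^d$ are Borel measurable maps. A cone is a set $C \subseteq \mathbb{R}^d$ with $sz \in C$ for all $s>0$, $z \in C$. The dual cone is $C^+ = \{w \in \mathbb{R}^d \mid w^Tz \geq 0 \text{ for all } z \in C\}$. For $w \in C^+\setminus\{0\}$ and $p \in [0,1]$, the upper $w$-quantile is $Q^+_{X,w}(p) = \{z \in \mathbb{R}^d \mid P(w^TX < w^Tz) \leq p\}$, and the upper $C$-quantile is $Q^+_{X,C}(p) = \bigcap_{w \in C^+\setminus\{0\}} Q^+_{X,w}(p)$. *)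

theory Defs
  imports "HOL-Probability.Probability"
begin

text \<open>Unlike the library's \<open>cone\<close>, only scaling by strictly positive factors is required, so the
  origin need not belong to a nonempty cone.\<close>
definition positive_cone :: "(real ^ 'd) set \<Rightarrow> bool" where
  "positive_cone C \<longleftrightarrow> (\<forall>s>0. \<forall>z\<in>C. s *\<^sub>R z \<in> C)"

definition dual_cone :: "(real ^ 'd) set \<Rightarrow> (real ^ 'd) set" where
  "dual_cone C = {w. \<forall>z\<in>C. w \<bullet> z \<ge> 0}"

text \<open>The supremum is taken in the reals. For a probability measure \<open>M\<close>, a random variable \<open>Y\<close> and
  \<open>0 < p < 1\<close> the set is nonempty and bounded above, so it is the genuine one; outside this range
  \<open>Sup\<close> may be an unspecified value.\<close>
definition upper_quantile :: "'a measure \<Rightarrow> ('a \<Rightarrow> real) \<Rightarrow> real \<Rightarrow> real" where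
  "upper_quantile M Y p = Sup {s. measure M {\<omega> \<in> space M. Y \<omega> < s} \<le> p}"

definition upper_w_quantile ::
  "'a measure \<Rightarrow> ('a \<Rightarrow> real ^ 'd) \<Rightarrow> real ^ 'd \<Rightarrow> real \<Rightarrow> (real ^ 'd) set" where
  "upper_w_quantile M X w p = {z. measure M {\<omega> \<in> space M. w \<bullet> X \<omega> < w \<bullet> z} \<le> p}"

definition upper_C_quantile ::
  "'a measure \<Rightarrow> ('a \<Rightarrow> real ^ 'd) \<Rightarrow> (real ^ 'd) set \<Rightarrow> real \<Rightarrow> (real ^ 'd) set" where
  "upper_C_quantile M X C p = (\<Inter>w \<in> dual_cone C - {0}. upper_w_quantile M X w p)"

end

theory Submission
  imports Defs
begin

text \<open>The map \<open>s \<mapsto> P(Y < s)\<close> is nondecreasing and left-continuous with limits \<open>0\<close> and \<open>1\<close> at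
  the two infinities, so its sublevel set at a level \<open>0 < p < 1\<close> is a closed half-line ending at
  the upper quantile. Apply this to \<open>Y = w \<bullet> X\<close> and \<open>s = w \<bullet> z\<close>.\<close>

context prob_space
begin

lemma prob_less_mono:
  fixes Y :: "'a \<Rightarrow> real"
  assumes [measurable]: "Y \<in> borel_measurable M" and "s \<le> t"
  shows "prob {\<omega> \<in> space M. Y \<omega> < s} \<le> prob {\<omega> \<in> space M. Y \<omega> < t}"
  by (rule finite_measure_mono) (use assms(2) in auto)

text \<open>Continuity from above: since \<open>Y\<close> is real-valued, the events
  \<open>Y \<omega> < - real n\<close> decrease to the empty set, so their probabilities eventually
  fall below \<open>p\<close>. This keeps the \<open>Sup\<close> in \<open>upper_quantile\<close>
  from being taken over the empty set.\<close>

lemma prob_less_sublevel_nonempty: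
  fixes Y :: "'a \<Rightarrow> real"
  assumes [measurable]: "Y \<in> borel_measurable M" and "0 < p"
  shows "\<exists>s. prob {\<omega> \<in> space M. Y \<omega> < s} \<le> p"
proof -
  let ?A = "\<lambda>n::nat. {\<omega> \<in> space M. Y \<omega> < - real n}"
  have "(\<lambda>n. prob (?A n)) \<longlonglongrightarrow> prob (\<Inter>n. ?A n)"
    by (rule finite_Lim_measure_decseq) (auto simp: decseq_def)
  also have "(\<Inter>n. ?A n) = {}"
  proof -
    have "\<exists>n::nat. \<not> Y \<omega> < - real n" for \<omega>
    proof -
      obtain n :: nat where "- Y \<omega> < real n" using reals_Archimedean2 by blast
      then have "\<not> Y \<omega> < - real n" by linarith
      then show ?thesis ..
    qed
    then show ?thesis by blast
  qed
  finally have "\<forall>\<^sub>F n in sequentially. prob (?A n) < p"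
    using \<open>0 < p\<close> by (intro order_tendstoD(2)) simp_all
  then obtain n where "prob (?A n) < p"
    using eventually_happens'[OF sequentially_bot] by blast
  then show ?thesis
    by (intro exI[of _ "- real n"]) simp
qed

text \<open>Continuity from below: the events \<open>Y \<omega> < real n\<close> exhaust the space,
  so one of them has probability above \<open>p\<close>, and that \<open>n\<close> is an upper
  bound.\<close>

lemma prob_less_sublevel_bdd_above:
  fixes Y :: "'a \<Rightarrow> real"
  assumes [measurable]: "Y \<in> borel_measurable M" and "p < 1"
  shows "bdd_above {s. prob {\<omega> \<in> space M. Y \<omega> < s} \<le> p}"
proof -
  let ?A = "\<lambda>n::nat. {\<omega> \<in> space M. Y \<omega> < real n}"
  have "(\<lambda>n. prob (?A n)) \<longlonglongrightarrow> prob (\<Union>n. ?A n)"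
    by (rule finite_Lim_measure_incseq) (auto simp: incseq_def)
  also have "(\<Union>n. ?A n) = space M"
    using reals_Archimedean2 by auto
  finally have "\<forall>\<^sub>F n in sequentially. p < prob (?A n)"
    using \<open>p < 1\<close> by (intro order_tendstoD(1)) (simp_all add: prob_space)
  then obtain n where n: "p < prob (?A n)"
    using eventually_happens'[OF sequentially_bot] by blast
  show ?thesis
  proof (rule bdd_aboveI)
    fix s assume "s \<in> {s. prob {\<omega> \<in> space M. Y \<omega> < s} \<le> p}"
    \<comment> \<open>If \<open>real n < s\<close>, monotonicity would give p < P(Y < n) \<le> P(Y <
      s) \<le> p.\<close>
    then show "s \<le> real n"
      using n prob_less_mono[OF assms(1), of "real n" s] by (cases "s \<le> real n") auto
  qed
qed

text \<open>Left-continuity in the form needed below: because the inequality is strict, the event Y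
  < t is an increasing union of events Y < s with s < t, and the bound \<open>p\<close> survives the
  limit. It places the supremum itself in the sublevel set.\<close>

lemma prob_less_le_if_below:
  fixes Y :: "'a \<Rightarrow> real"
  assumes [measurable]: "Y \<in> borel_measurable M"
    and below: "\<And>s. s < t \<Longrightarrow> prob {\<omega> \<in> space M. Y \<omega> < s} \<le> p"
  shows "prob {\<omega> \<in> space M. Y \<omega> < t} \<le> p"
proof -
  \<comment> \<open>\<open>Suc n\<close> avoids the default 1 / 0 = 0: with it the first threshold
    would be \<open>t\<close> itself, where \<open>below\<close> says nothing and from which the
    events could not increase.\<close>
  let ?A = "\<lambda>n::nat. {\<omega> \<in> space M. Y \<omega> < t - 1 / real (Suc n)}"
  have "incseq ?A"
  proof (rule monoI)
    fix m n :: nat assume "m \<le> n"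
    then have "1 / real (Suc n) \<le> 1 / real (Suc m)"
      by (intro divide_left_mono) simp_all
    then show "?A m \<subseteq> ?A n" by fastforce
  qed
  then have "(\<lambda>n. prob (?A n)) \<longlonglongrightarrow> prob (\<Union>n. ?A n)"
    by (intro finite_Lim_measure_incseq) auto
  moreover have "(\<Union>n. ?A n) = {\<omega> \<in> space M. Y \<omega> < t}"
  proof -
    have "(\<exists>n::nat. y < t - 1 / real (Suc n)) \<longleftrightarrow> y < t" for y
    proof
      assume "\<exists>n::nat. y < t - 1 / real (Suc n)"
      then obtain n :: nat where "y < t - 1 / real (Suc n)" ..
      moreover have "0 < 1 / real (Suc n)" by simp
      ultimately show "y < t" by linarith
    next
      assume "y < t"
      then obtain n :: nat where "1 / real (Suc n) < t - y"
        using nat_approx_posE[of "t - y"] by auto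
      then have "y < t - 1 / real (Suc n)" by linarith
      then show "\<exists>n::nat. y < t - 1 / real (Suc n)" ..
    qed
    then show ?thesis by blast
  qed
  ultimately have "(\<lambda>n. prob (?A n)) \<longlonglongrightarrow> prob {\<omega> \<in> space M. Y \<omega> < t}"
    by simp
  then show ?thesis
    by (rule LIMSEQ_le_const2) (simp add: below)
qed

lemma prob_less_le_iff_upper_quantile:
  fixes Y :: "'a \<Rightarrow> real"
  assumes Y: "Y \<in> borel_measurable M" and p: "0 < p" "p < 1"
  shows "prob {\<omega> \<in> space M. Y \<omega> < t} \<le> p \<longleftrightarrow> t \<le> upper_quantile M Y p"
proof
  assume "prob {\<omega> \<in> space M. Y \<omega> < t} \<le> p"
  then show "t \<le> upper_quantile M Y p"
    unfolding upper_quantile_def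
    by (intro cSup_upper prob_less_sublevel_bdd_above Y p) simp
next
  assume t: "t \<le> upper_quantile M Y p"
  show "prob {\<omega> \<in> space M. Y \<omega> < t} \<le> p"
  \<comment> \<open>It is not yet known that the supremum is attained, so \<open>t\<close> is
    approached from the left: each s < t lies strictly below the supremum, hence below some member
    \<open>r\<close> of the sublevel set, and monotonicity carries the bound from \<open>r\<close>
    down to \<open>s\<close>.\<close>
  proof (rule prob_less_le_if_below[OF Y])
    fix s assume "s < t"
    with t have "s < Sup {s. prob {\<omega> \<in> space M. Y \<omega> < s} \<le> p}"
      by (simp add: upper_quantile_def)
    then obtain r where "prob {\<omega> \<in> space M. Y \<omega> < r} \<le> p" "s < r"
      using less_cSupD[of "{s. prob {\<omega> \<in> space M. Y \<omega> < s} \<le> p}" s]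
        prob_less_sublevel_nonempty[OF Y p(1)] by blast
    then show "prob {\<omega> \<in> space M. Y \<omega> < s} \<le> p"
      using prob_less_mono[OF Y, of s r] by simp
  qed
qed

end

theorem proposition4p3:
  fixes M :: "'a measure"
    and X :: "'a \<Rightarrow> real ^ 'd"
    and C :: "(real ^ 'd) set"
  assumes "prob_space M"
    and "X \<in> borel_measurable M"
    and "C \<noteq> UNIV" and "closed C" and "convex C" and "positive_cone C" and "0 \<in> C"
  shows "(\<forall>p\<in>{0<..<1}. \<forall>w \<in> dual_cone C - {0}.
            upper_w_quantile M X w p = {z. w \<bullet> z \<le> upper_quantile M (\<lambda>\<omega>. w \<bullet> X \<omega>) p}) \<and>
         (\<forall>p\<in>{0<..<1}.
            upper_C_quantile M X C p =
              (\<Inter>w \<in> dual_cone C - {0}. {z. w \<bullet> z \<le> upper_quantile M (\<lambda>\<omega>. w \<bullet> X \<omega>) p}))"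
proof -
  interpret prob_space M by fact
  have "upper_w_quantile M X w p = {z. w \<bullet> z \<le> upper_quantile M (\<lambda>\<omega>. w \<bullet> X \<omega>) p}"
    if "p \<in> {0<..<1}" for p w
    unfolding upper_w_quantile_def
    using that assms(2) by (subst prob_less_le_iff_upper_quantile) auto
  then show ?thesis
    by (simp add: upper_C_quantile_def)
qed

end
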